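(* Let $f \in R[z]$, where $R$ is a ring. Given a straight-line program for $f$, together with bounds $T \ge t$ and $D\ge d$, where $t$ is the number of non-zero coefficients of $f$ and $d$ is its degree, one can find all coefficients and exponents of $f$ with probability at least $1-\mu$ using $\tilde{O}\left( \log T\left(\log D + \log \tfrac{1}{\mu}\right) \right)$ probes of degree at most $O( T \log^2 D )$.
   Context: Sparse polynomial: $f = c_1 z^{e_1} + \cdots + c_t z^{e_t} \in R[z]$ with non-zero coefficients $c_i\in R$ and distinct exponents $e_i$; $t$ is called the sparsity of $f$. Straight-line program (univariate case): a straight-line program of length $L$ over $R$ takes an input $a \in R$ and produces a vector $(\gamma_1,\ldots,\gamma_L)\in R^L$ via a series of $L$ instructions $\Gamma_1,\ldots,\Gamma_L$, where $\Gamma_i$ has either the form $\gamma_i \leftarrow \alpha_1 \star \alpha_2$ with $\star$ one of the ring operations $+,-,\times$ and each $\alpha_\ell$ ($\ell = 1,2$) either equal to the input $a$ or in $\{\gamma_k : 1\le k<i\}$, or the form $\gamma_i \leftarrow \delta$ for a constant $\delta\in R$. It computes $f$ if it sets $\gamma_L$ to $f(a)$. The program can also be run over the extension rings $R[z]/(z^\ell-1)$, $\ell\ge 1$, by replacing operations in $R$ by operations in $R[z]/(z^\ell-1)$ (elements being represented by polynomials of degree less than $\ell$), which evaluates $f$ in that extension ring. Probe: each evaluation of the straight-line program for $f$ in $R[z]/(z^\ell-1)$ is called a probe of degree $\ell$; in particular, evaluating at $z$ yields $f \bmod (z^\ell-1)$. The algorithm is probabilistic (it may use random bits), and $\mu>0$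 is a user-supplied bound on the probability of failure. Soft-Oh notation: for functions $\phi,\psi$ with positive real values, $\phi\in\tilde{O}(\psi)$ if and only if $\phi\in O(\psi(\log\psi)^c)$ for some constant $c\ge 0$. *)

theory Defs
  imports
    "HOL-Probability.Probability"
    "HOL-Computational_Algebra.Polynomial"
    "HOL-Library.Landau_Symbols"
begin

section \<open>Sparse representation\<close>

definition sparsity :: "'a::zero poly \<Rightarrow> nat" where
  "sparsity f = card {e. coeff f e \<noteq> 0}"

definition sparse_rep :: "'a::zero poly \<Rightarrow> ('a \<times> nat) list \<Rightarrow> bool" where
  "sparse_rep f xs \<longleftrightarrow> distinct xs \<and> set xs = {(coeff f e, e) | e. coeff f e \<noteq> 0}"


section \<open>The rings \<open>R[z]/(z^l - 1)\<close>\<close>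

text \<open>
  Division with remainder of polynomials is only available over fields in the library, so the
  canonical representative of degree less than \<open>l\<close> is given explicitly, by folding exponents
  modulo \<open>l\<close>; \<open>cyc_red_unique\<close> characterises it. For \<open>l = 0\<close> the map is the identity.
\<close>

definition cyc_red :: "nat \<Rightarrow> 'a::comm_ring_1 poly \<Rightarrow> 'a poly" where
  "cyc_red l f = (\<Sum>i\<le>degree f. monom (coeff f i) (i mod l))"

lemma degree_cyc_red_less:
  assumes "0 < l"
  shows "degree (cyc_red l f) < l"
proof -
  have "degree (cyc_red l f) \<le> l - 1"
    unfolding cyc_red_def
  proof (rule degree_sum_le)
    fix i assume "i \<in> {..degree f}"
    have "i mod l \<le> l - 1" using assms mod_less_divisor[of l i] by linarith
    then show "degree (monom (coeff f i) (i mod l)) \<le> l - 1"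
      using degree_monom_le[of "coeff f i" "i mod l"] by linarith
  qed simp
  then show ?thesis using assms by linarith
qed

lemma dvd_diff_cyc_red: "(monom 1 l - 1) dvd (f - cyc_red l f)"
proof -
  have pow: "(monom 1 l - 1) dvd (monom 1 (l * k) - (1 :: 'a poly))" for k
  proof -
    have "monom 1 l - 1 dvd (monom 1 l) ^ k - (1 :: 'a poly)"
      using power_diff_1_eq[of "monom 1 l :: 'a poly" k] by simp
    then show ?thesis by (simp add: monom_power)
  qed
  have one: "(monom 1 l - 1) dvd (monom c i - monom c (i mod l))" for c :: 'a and i
  proof -
    have "monom c i - monom c (i mod l)
        = monom c (i mod l) * (monom 1 (l * (i div l)) - 1)"
      by (simp add: right_diff_distrib mult_monom)
    then show ?thesis using pow by (simp add: dvd_mult)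
  qed
  have "f - cyc_red l f
      = (\<Sum>i\<le>degree f. monom (coeff f i) i - monom (coeff f i) (i mod l))"
    by (simp add: cyc_red_def sum_subtractf poly_as_sum_of_monoms)
  then show ?thesis using one by (simp add: dvd_sum)
qed

lemma cyc_red_unique:
  assumes "0 < l"
  shows "r = cyc_red l f \<longleftrightarrow> degree r < l \<and> (monom 1 l - 1) dvd (f - r)"
proof
  assume "r = cyc_red l f"
  then show "degree r < l \<and> (monom 1 l - 1) dvd (f - r)"
    using degree_cyc_red_less[OF assms] dvd_diff_cyc_red by auto
next
  assume r: "degree r < l \<and> (monom 1 l - 1) dvd (f - r)"
  define m where "m = (monom 1 l - 1 :: 'a poly)"
  have coeff_m: "coeff m l = 1" using assms by (simp add: m_def)
  have deg_m: "degree m = l"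
  proof (rule antisym)
    show "degree m \<le> l" unfolding m_def
      by (rule degree_diff_le) (simp_all add: degree_monom_le)
    show "l \<le> degree m" using coeff_m by (intro le_degree) simp
  qed
  have "m dvd (f - cyc_red l f) - (f - r)"
    unfolding m_def using r dvd_diff[OF dvd_diff_cyc_red] by blast
  then obtain q where q: "r - cyc_red l f = m * q" by (auto simp: dvd_def)
  have "degree (r - cyc_red l f) < l"
    using r degree_cyc_red_less[OF assms] by (intro degree_diff_less) auto
  moreover have "coeff (m * q) (l + degree q) = lead_coeff q"
    using coeff_mult_degree_sum[of m q] coeff_m deg_m by simp
  ultimately have "lead_coeff q = 0"
    unfolding q by (metis coeff_eq_0 trans_less_add1)
  then show "r = cyc_red l f" using q by simp
qed


section \<open>Straight-line programs\<close>

datatype operand = Input | Res nat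

datatype ring_op = Add | Sub | Mul

datatype 'a instr = Op ring_op operand operand | Const 'a

type_synonym 'a slp = "'a instr list"

text \<open>
  Results are numbered from 0: instruction \<open>i\<close> may refer to \<open>Res k\<close> only for \<open>k < i\<close>. Programs are
  non-empty, so that there is a last result.
\<close>

fun operand_ok :: "nat \<Rightarrow> operand \<Rightarrow> bool" where
  "operand_ok i Input \<longleftrightarrow> True"
| "operand_ok i (Res k) \<longleftrightarrow> k < i"

fun instr_ok :: "nat \<Rightarrow> 'a instr \<Rightarrow> bool" where
  "instr_ok i (Op _ u v) \<longleftrightarrow> operand_ok i u \<and> operand_ok i v"
| "instr_ok i (Const _) \<longleftrightarrow> True"

definition wf_slp :: "'a slp \<Rightarrow> bool" where
  "wf_slp P \<longleftrightarrow> P \<noteq> [] \<and> (\<forall>i < length P. instr_ok i (P ! i))"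

fun ring_op_fun :: "ring_op \<Rightarrow> 'b::comm_ring_1 \<Rightarrow> 'b \<Rightarrow> 'b" where
  "ring_op_fun Add x y = x + y"
| "ring_op_fun Sub x y = x - y"
| "ring_op_fun Mul x y = x * y"

text \<open>
  Execution is generic in the interpretation \<open>ops\<close> of the ring operations and the embedding \<open>emb\<close>
  of constants, so that a program over \<open>R\<close> can also be run over an extension ring. The list
  \<open>\<gamma>\<close> holds the results of the previous instructions.
\<close>

fun operand_val :: "'b \<Rightarrow> 'b list \<Rightarrow> operand \<Rightarrow> 'b" where
  "operand_val a \<gamma> Input = a"
| "operand_val a \<gamma> (Res k) = \<gamma> ! k"

fun instr_val :: "(ring_op \<Rightarrow> 'b \<Rightarrow> 'b \<Rightarrow> 'b) \<Rightarrow> ('a \<Rightarrow> 'b) \<Rightarrow> 'b \<Rightarrow> 'b list \<Rightarrow> 'a instr \<Rightarrow> 'b" where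
  "instr_val ops emb a \<gamma> (Op p u v) = ops p (operand_val a \<gamma> u) (operand_val a \<gamma> v)"
| "instr_val ops emb a \<gamma> (Const \<delta>) = emb \<delta>"

definition slp_results ::
    "(ring_op \<Rightarrow> 'b \<Rightarrow> 'b \<Rightarrow> 'b) \<Rightarrow> ('a \<Rightarrow> 'b) \<Rightarrow> 'b \<Rightarrow> 'a slp \<Rightarrow> 'b list" where
  "slp_results ops emb a P = foldl (\<lambda>\<gamma> ins. \<gamma> @ [instr_val ops emb a \<gamma> ins]) [] P"

definition slp_eval :: "'a::comm_ring_1 slp \<Rightarrow> 'a \<Rightarrow> 'a" where
  "slp_eval P a = last (slp_results ring_op_fun (\<lambda>c. c) a P)"

text \<open>
  Evaluation in \<open>R[z]/(z^l - 1)\<close>, meaningful for \<open>l \<ge> 1\<close>, at the class of the polynomial \<open>a\<close>.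
\<close>

definition slp_eval_cyc :: "'a::comm_ring_1 slp \<Rightarrow> nat \<Rightarrow> 'a poly \<Rightarrow> 'a poly" where
  "slp_eval_cyc P l a =
     last (slp_results (\<lambda>p x y. cyc_red l (ring_op_fun p x y)) (\<lambda>c. [:c:]) (cyc_red l a) P)"

text \<open>
  Agreement on \<open>R\<close> alone does not determine \<open>f\<close> when \<open>R\<close> is finite (for instance \<open>z\<close> and \<open>z^2\<close>
  over the field with two elements), and would not guarantee that a run in \<open>R[z]/(z^l - 1)\<close>
  evaluates \<open>f\<close> there. Agreement in these extension rings is therefore part of the definition.
\<close>

definition slp_computes :: "'a::comm_ring_1 slp \<Rightarrow> 'a poly \<Rightarrow> bool" where
  "slp_computes P f \<longleftrightarrow> wf_slp P \<and>
     (\<forall>a. slp_eval P a = poly f a) \<and>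
     (\<forall>l \<ge> 1. \<forall>a. slp_eval_cyc P l a = cyc_red l (pcompose f a))"


section \<open>Randomised algorithms with probes\<close>

text \<open>
  An algorithm may toss a fair coin, probe the unknown program (choosing the degree \<open>l\<close> and the
  evaluation point adaptively), or stop with a list of (coefficient, exponent) pairs. Since it
  sees the program only through the answers to its probes, it cannot read off \<open>f\<close> by other means.
  Computation between probes is not charged.
\<close>

declare [[typedef_overloaded]]

datatype 'a probe_alg =
    Output "('a \<times> nat) list"
  | Toss "bool \<Rightarrow> 'a probe_alg"
  | Probe nat "'a poly" "'a poly \<Rightarrow> 'a probe_alg"

text \<open>
  The joint distribution of the output and the list of degrees of all probes made.
\<close>

primrec run_alg ::
    "'a::comm_ring_1 slp \<Rightarrow> 'a probe_alg \<Rightarrow> (('a \<times> nat) list \<times> nat list) pmf" where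
  "run_alg P (Output xs) = return_pmf (xs, [])"
| "run_alg P (Toss k) = bind_pmf (bernoulli_pmf (1/2)) (\<lambda>b. run_alg P (k b))"
| "run_alg P (Probe l a k) =
     map_pmf (\<lambda>(xs, ls). (xs, l # ls)) (run_alg P (k (slp_eval_cyc P l a)))"


section \<open>Asymptotics\<close>

text \<open>
  For several parameters ranging over a set \<open>S\<close>, \<open>\<phi> \<in> O(\<psi>)\<close> is read as \<open>O[principal S]\<close>, i.e.\ with
  one constant for all points of \<open>S\<close>. For Soft-Oh this is too strict near \<open>\<psi> = 1\<close>, where
  \<open>log \<psi>\<close> vanishes, so there the estimate is required on \<open>S\<close> as \<open>\<psi>\<close> tends to infinity.
\<close>

definition soft_O :: "'p set \<Rightarrow> ('p \<Rightarrow> real) \<Rightarrow> ('p \<Rightarrow> real) set" where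
  "soft_O S \<psi> = (\<Union>c\<in>{0..}.
     O[inf (filtercomap \<psi> at_top) (principal S)](\<lambda>x. \<psi> x * ln (\<psi> x) powr c))"

text \<open>
  Parameters \<open>(T, D, \<mu>)\<close>. The values \<open>T \<le> 1\<close> and \<open>D \<le> 1\<close> are excluded from the complexity
  bounds since \<open>ln T\<close>, resp. \<open>ln D\<close>, is not positive there.
\<close>

definition params :: "(nat \<times> nat \<times> real) set" where
  "params = {(T, D, \<mu>). 2 \<le> T \<and> 2 \<le> D \<and> 0 < \<mu> \<and> \<mu> < 1}"

end

theory Submission
  imports Defs
begin

text \<open>
  Only probes are charged, so the decoder may inspect every exponent \<open>e \<le> D\<close> separately. Call a
  modulus \<open>l\<close> ambiguous for \<open>e\<close> if another exponent of \<open>f\<close> is congruent to \<open>e\<close> modulo \<open>l\<close>;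
  otherwise the coefficient of \<open>f mod (z^l - 1)\<close> at \<open>e mod l\<close> is the coefficient of \<open>f\<close> at \<open>e\<close>, be it
  zero or not. A nonzero difference of exponents has at most \<open>log D\<close> prime divisors, so among
  \<open>8 T log D\<close> primes at most one in eight is ambiguous for a given \<open>e\<close>. If \<open>2 w\<close> primes are drawn at
  random, half of them are ambiguous for \<open>e\<close> with probability at most \<open>2 powr (-w)\<close>, and a union bound
  over \<open>e \<le> D\<close> shows that \<open>w = log (D / \<mu>)\<close> suffices to recover all coefficients by majority vote.
  Chebyshev's lower bound on the number of primes (obtained from the least common multiple of
  \<open>1, \<dots>, N\<close>) provides enough primes below \<open>O(T log\<^sup>2 D)\<close> as long as \<open>T \<le> D\<close>; if \<open>T > D\<close>, a single
  probe of degree \<open>D + 1\<close> reveals \<open>f\<close>.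
\<close>

section \<open>Counting primes\<close>

text \<open>Leibniz harmonic triangle: \<open>1 / (Suc k * (n choose Suc k))\<close> is the
  difference of \<open>1 / (k * (n - 1 choose k))\<close> and \<open>1 / (k * (n choose k))\<close>.
  Multiplied by \<open>L\<close>, the two right-hand terms are integers by induction, hence so is
  the left. The difference is formed in the integers.\<close>

lemma mult_binomial_dvd:
  fixes L :: nat
  assumes "\<And>m. 1 \<le> m \<Longrightarrow> m \<le> n \<Longrightarrow> m dvd L" and "1 \<le> k" "k \<le> n"
  shows "k * (n choose k) dvd L"
  using assms(2,1,3)
proof (induction k arbitrary: n rule: dec_induct)
  case base
  then show ?case by simp
next
  case (step k)
  have "k * (n - 1 choose k) dvd L" "k * (n choose k) dvd L"
    by (rule step.IH; use step.prems in auto)+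
  then obtain z1 z2 where z: "L = k * (n - 1 choose k) * z1" "L = k * (n choose k) * z2"
    by (elim dvdE)
  have "(int n - int k) * int (n choose k) = int n * int (n - 1 choose k)"
    using binomial_absorb_comp[of n k] step.prems
    by (metis Suc_leD of_nat_diff of_nat_mult)
  have absorb: "int (Suc k * (n choose Suc k)) = int n * int (n - 1 choose k)"
    by (subst binomial_absorption) simp
  have "int k * (int (Suc k * (n choose Suc k)) * (int z1 - int z2)) =
      int n * (int k * int (n - 1 choose k) * int z1) -
      int z2 * int k * (int n * int (n - 1 choose k))"
    unfolding absorb by (simp add: algebra_simps)
  also have "int k * int (n - 1 choose k) * int z1 = int L"
    using z(1) by (metis of_nat_mult)
  also have "int n * int (n - 1 choose k) = (int n - int k) * int (n choose k)"
    by (simp add: \<open>(int n - int k) * int (n choose k) = int n * int (n - 1 choose k)\<close>)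
  also have "int z2 * int k * ((int n - int k) * int (n choose k)) = (int n - int k) * int L"
    by (subst z(2)) (simp add: algebra_simps)
  finally have "int k * (int (Suc k * (n choose Suc k)) * (int z1 - int z2)) = int k * int L"
    by (simp add: algebra_simps)
  then have "int (Suc k * (n choose Suc k)) * (int z1 - int z2) = int L"
    using step.hyps by simp
  then have "int (Suc k * (n choose Suc k)) dvd int L"
    by (metis dvd_triv_left)
  then show ?case by (simp only: of_nat_dvd_iff)
qed

text \<open>The witness is the least common multiple of 1 to \<open>N\<close>: the product, over the
  primes up to \<open>N\<close>, of their largest powers not exceeding \<open>N\<close>. Each factor
  is at most \<open>N\<close>.\<close>

lemma common_multiple_le_power_primes:
  fixes N :: nat
  assumes "N \<ge> 1"
  obtains L where "L > 0" "\<And>m. 1 \<le> m \<Longrightarrow> m \<le> N \<Longrightarrow> m dvd L" "L \<le> N ^ card {p. prime p \<and> p \<le> N}"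
proof
  define S where "S = {p. prime p \<and> p \<le> N}"
  define h where "h p = (GREATEST e. p ^ e \<le> N)" for p
  have fin: "finite S" unfolding S_def by (rule finite_subset[of _ "{..N}"]) auto
  \<comment> \<open>This bound on the exponents makes the \<open>GREATEST\<close> in
    \<open>h\<close> attained.\<close>
  have bnd: "e \<le> N" if "p \<in> S" "p ^ e \<le> N" for p e
  proof -
    have "2 ^ e \<le> p ^ e" using that by (intro power_mono) (auto simp: S_def prime_ge_2_nat)
    then show ?thesis using that less_exp[of e] by linarith
  qed
  have h_le: "p ^ h p \<le> N" if "p \<in> S" for p
    unfolding h_def by (rule GreatestI_nat[of _ 0 N]) (use bnd that assms in auto)
  have h_ge: "e \<le> h p" if "p \<in> S" "p ^ e \<le> N" for p e
    unfolding h_def by (rule Greatest_le_nat[of _ _ N]) (use bnd that assms in auto)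
  let ?L = "\<Prod>p\<in>S. p ^ h p"
  show "?L > 0" by (intro prod_pos) (auto simp: S_def prime_gt_0_nat)
  show "m dvd ?L" if "1 \<le> m" "m \<le> N" for m
  proof (rule multiplicity_le_imp_dvd)
    show "m \<noteq> 0" using that by simp
    fix p :: nat assume p: "prime p"
    have mult: "p ^ multiplicity p m \<le> N"
      using that dvd_imp_le[OF multiplicity_dvd[of p m]] by linarith
    show "multiplicity p m \<le> multiplicity p ?L"
    proof (cases "p \<in> S")
      case True
      then show ?thesis using h_ge[OF True mult] p
        by (subst multiplicity_prod_prime_powers[OF fin]) (auto simp: S_def)
    next
      case False
      then have "\<not> p dvd m" using p that dvd_imp_le[of p m] by (auto simp: S_def)
      then show ?thesis by (simp add: not_dvd_imp_multiplicity_0)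
    qed
  qed
  have "?L \<le> (\<Prod>p\<in>S. N)" by (intro prod_mono) (use h_le in auto)
  then show "?L \<le> N ^ card {p. prime p \<and> p \<le> N}" by (simp add: S_def)
qed

text \<open>Chebyshev's argument with \<open>k = s * j\<close>: the number
  \<open>k * (2 * k choose k)\<close> is at least \<open>4 ^ k / 2\<close>, hence at least
  \<open>2 ^ k\<close>, and divides a common multiple of size at most
  \<open>(2 * k) ^ \<pi>\<close>, which is at most \<open>2 ^ (s * \<pi>)\<close>. Comparing
  exponents and cancelling \<open>s\<close> avoids logarithms.\<close>

lemma card_primes_ge:
  fixes s j :: nat
  assumes "1 \<le> j" "1 \<le> s" "2 * (s * j) \<le> 2 ^ s"
  shows "j \<le> card {p. prime p \<and> p \<le> 2 * (s * j)}"
proof -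
  define k where "k = s * j"
  define \<pi> where "\<pi> = card {p::nat. prime p \<and> p \<le> 2 * k}"
  have k: "k \<ge> 1" using assms by (simp add: k_def)
  obtain L where L: "L > 0" "\<And>m. 1 \<le> m \<Longrightarrow> m \<le> 2 * k \<Longrightarrow> m dvd L" "L \<le> (2 * k) ^ \<pi>"
    unfolding \<pi>_def using common_multiple_le_power_primes[of "2 * k"] k by auto
  have "k * (2 * k choose k) dvd L" by (rule mult_binomial_dvd) (use L k in auto)
  then have "k * (2 * k choose k) \<le> L" using L by (auto dest: dvd_imp_le)
  also have "L \<le> (2 ^ s) ^ \<pi>"
    using L(3) power_mono[of "2 * k" "2 ^ s" \<pi>] assms by (auto simp: k_def)
  finally have "real (k * (2 * k choose k)) \<le> (2 ^ s) ^ \<pi>" by (metis of_nat_le_iff of_nat_numeral of_nat_power)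
  moreover have "4 ^ k / 2 \<le> real (k * (2 * k choose k))"
    using central_binomial_lower_bound[of k] k by (simp add: field_simps)
  moreover have "(2::real) * 2 ^ k \<le> 4 ^ k"
  proof -
    have "(2::real) \<le> 2 ^ k" using k self_le_power[of "2::real" k] by simp
    then have "2 * 2 ^ k \<le> 2 ^ k * (2::real) ^ k" by simp
    also have "\<dots> = 4 ^ k" by (simp flip: power_mult_distrib)
    finally show ?thesis .
  qed
  ultimately have "(2::real) ^ k \<le> 2 ^ (s * \<pi>)" by (simp add: power_mult)
  then have "s * j \<le> s * \<pi>" by (simp add: k_def)
  then show ?thesis using assms by (simp add: \<pi>_def k_def)
qed

text \<open>The product of the distinct prime divisors divides \<open>d\<close>, and each of them is
  at least 2.\<close>

lemma card_prime_divisors_le: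
  fixes d b :: nat
  assumes "0 < d" "d < 2 ^ b"
  shows "finite {p. prime p \<and> p dvd d}" "card {p. prime p \<and> p dvd d} \<le> b"
proof -
  let ?S = "{p. prime p \<and> p dvd d}"
  show fin: "finite ?S" 
    by (rule finite_subset[OF _ finite_divisors_nat[OF assms(1)]]) auto
  \<comment> \<open>The exponent 1 gives the product the shape expected by
    \<open>multiplicity_prod_prime_powers\<close>.\<close>
  have "(\<Prod>p\<in>?S. p ^ 1) dvd d"
  proof (rule multiplicity_le_imp_dvd)
    show "(\<Prod>p\<in>?S. p ^ 1) \<noteq> 0" using fin by (auto simp: prime_gt_0_nat)
    fix q :: nat assume q: "prime q"
    show "multiplicity q (\<Prod>p\<in>?S. p ^ 1) \<le> multiplicity q d"
      by (subst multiplicity_prod_prime_powers[OF fin])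
         (use q assms in \<open>auto simp: Suc_le_eq prime_multiplicity_gt_zero_iff\<close>)
  qed
  then have "(\<Prod>p\<in>?S. p) \<le> d" using assms by (auto dest: dvd_imp_le)
  moreover have "(\<Prod>p\<in>?S. 2) \<le> (\<Prod>p\<in>?S. p)"
    by (intro prod_mono) (auto simp: prime_ge_2_nat)
  ultimately have "2 ^ card ?S \<le> d" by simp
  then have "2 ^ card ?S < (2::nat) ^ b" using assms(2) by (rule le_less_trans)
  then show "card ?S \<le> b" by simp
qed

section \<open>Decoding by majority vote\<close>

lemma coeff_cyc_red:
  assumes "\<And>i. i \<noteq> e \<Longrightarrow> coeff f i \<noteq> 0 \<Longrightarrow> i mod l \<noteq> e mod l"
  shows "coeff (cyc_red l f) (e mod l) = coeff f e"
proof -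
  have "coeff (cyc_red l f) (e mod l) = (\<Sum>i\<le>degree f. if i mod l = e mod l then coeff f i else 0)"
    by (simp add: cyc_red_def coeff_sum)
  also have "\<dots> = (\<Sum>i\<le>degree f. if i = e then coeff f e else 0)"
    by (rule sum.cong) (use assms in auto)
  \<comment> \<open>If \<open>e\<close> exceeds the degree, no summand matches and both sides are
    0.\<close>
  also have "\<dots> = coeff f e"
    by (simp add: coeff_eq_0)
  finally show ?thesis .
qed

text \<open>A strict majority is unique when it exists. Otherwise the value is unspecified; the
  failure bound covers such samples.\<close>

definition majority :: "'b list \<Rightarrow> 'b" where
  "majority xs = (THE x. length xs < 2 * length (filter ((=) x) xs))"

lemma majority_eq:
  assumes "length xs < 2 * length (filter ((=) x) xs)"
  shows "majority xs = x"
  unfolding majority_def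
proof (rule the_equality[where P = "\<lambda>x. length xs < 2 * length (filter ((=) x) xs)"])
  fix y assume y: "length xs < 2 * length (filter ((=) y) xs)"
  have "length (filter ((=) x) xs) + length (filter ((=) y) xs) \<le> length xs" if "x \<noteq> y"
    using that by (induction xs) auto
  then show "y = x" using assms y by fastforce
qed (fact assms)

definition decode :: "nat \<Rightarrow> (nat \<times> 'a::comm_ring_1 poly) list \<Rightarrow> ('a \<times> nat) list" where
  "decode D rs = filter (\<lambda>(c, e). c \<noteq> 0)
     (map (\<lambda>e. (majority (map (\<lambda>(l, r). coeff r (e mod l)) rs), e)) [0..<Suc D])"

lemma sparse_rep_decode:
  assumes "degree f \<le> D"
    and "\<And>e. e \<le> D \<Longrightarrow> majority (map (\<lambda>(l, r). coeff r (e mod l)) rs) = coeff f e"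
  shows "sparse_rep f (decode D rs)"
proof -
  have "decode D rs = filter (\<lambda>(c, e). c \<noteq> 0) (map (\<lambda>e. (coeff f e, e)) [0..<Suc D])"
    unfolding decode_def using assms(2) by (intro arg_cong[where f = "filter _"] map_cong) auto
  moreover have "distinct \<dots>"
    by (rule distinct_filter) (auto simp: distinct_map inj_on_def)
  moreover have "e \<le> D" if "coeff f e \<noteq> 0" for e
    using le_degree[OF that] assms(1) by simp
  then have "set (filter (\<lambda>(c, e). c \<noteq> 0) (map (\<lambda>e. (coeff f e, e)) [0..<Suc D])) =
      {(coeff f e, e) | e. coeff f e \<noteq> 0}"
    by (auto simp: less_Suc_eq_le simp del: upt_Suc)
  ultimately show ?thesis by (simp add: sparse_rep_def)
qed

definition ambiguous :: "'a::zero poly \<Rightarrow> nat \<Rightarrow> nat \<Rightarrow> bool" where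
  "ambiguous f e l \<longleftrightarrow> (\<exists>i. i \<noteq> e \<and> coeff f i \<noteq> 0 \<and> i mod l = e mod l)"

lemma sparse_rep_decode_images:
  assumes "degree f \<le> D"
    and "\<And>e. e \<le> D \<Longrightarrow> 2 * length (filter (ambiguous f e) ls) < length ls"
  shows "sparse_rep f (decode D (map (\<lambda>l. (l, cyc_red l f)) ls))"
proof (rule sparse_rep_decode[OF assms(1)])
  fix e assume "e \<le> D"
  let ?xs = "map (\<lambda>l. coeff (cyc_red l f) (e mod l)) ls"
  have "length ls = length (filter (ambiguous f e) ls) + length (filter (\<lambda>l. \<not> ambiguous f e l) ls)"
    by (rule sum_length_filter_compl[symmetric])
  \<comment> \<open>Only an inequality: colliding terms may cancel, so an ambiguous modulus can
    still vote correctly.\<close>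
  also have "length (filter (\<lambda>l. \<not> ambiguous f e l) ls) \<le> length (filter ((=) (coeff f e)) ?xs)"
  proof (induction ls)
    case (Cons l ls)
    have "coeff (cyc_red l f) (e mod l) = coeff f e" if "\<not> ambiguous f e l"
      using that by (intro coeff_cyc_red) (auto simp: ambiguous_def)
    then show ?case using Cons by auto
  qed simp
  finally have "majority ?xs = coeff f e"
    using assms(2)[OF \<open>e \<le> D\<close>] by (intro majority_eq) simp
  then show "majority (map (\<lambda>(l, r). coeff r (e mod l)) (map (\<lambda>l. (l, cyc_red l f)) ls)) = coeff f e"
    by (simp add: comp_def)
qed

section \<open>Sampling random moduli\<close>

lemma prob_bind_pmf:
  "measure_pmf.prob (bind_pmf p N) X = (\<integral>x. measure_pmf.prob (N x) X \<partial>measure_pmf p)"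
proof -
  have "integrable (measure_pmf p) (\<lambda>x. measure_pmf.prob (N x) X)"
    by (rule measure_pmf.integrable_const_bound[where B = 1]) auto
  then have "ennreal (measure_pmf.prob (bind_pmf p N) X) =
      ennreal (\<integral>x. measure_pmf.prob (N x) X \<partial>measure_pmf p)"
    by (simp add: nn_integral_eq_integral flip: measure_pmf.emeasure_eq_measure)
       (simp add: measure_pmf.emeasure_eq_measure nn_integral_eq_integral)
  then show ?thesis by (simp add: integral_nonneg_AE)
qed

text \<open>A Chernoff bound: by the hypothesis, \<open>2 ^ c\<close> raised to the number of hits
  of \<open>B\<close> has expectation at most \<open>2 ^ n\<close>, and Markov's inequality bounds
  the tail. The induction carries this out by conditioning on the first draw.\<close>

lemma prob_replicate_pmf_filter_ge:
  assumes "(2 ^ c - 1) * measure_pmf.prob p {x. B x} \<le> 1"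
  shows "measure_pmf.prob (replicate_pmf n p) {xs. j \<le> length (filter B xs)} \<le> 2 ^ n / (2 ^ c) ^ j"
proof (induction n arbitrary: j)
  case 0
  then show ?case by (cases j) (auto simp: indicator_def)
next
  case (Suc n)
  show ?case
  proof (cases j)
    case 0
    then show ?thesis by (simp add: order_trans[OF measure_pmf.prob_le_1] del: power_Suc)
  next
    case (Suc i)
    define \<beta> where "\<beta> = measure_pmf.prob p {x. B x}"
    let ?P = "\<lambda>j. measure_pmf.prob (replicate_pmf n p) {xs. j \<le> length (filter B xs)}"
    have "measure_pmf.prob (replicate_pmf (Suc n) p) {xs. j \<le> length (filter B xs)} =
      (\<integral>x. measure_pmf.prob (map_pmf ((#) x) (replicate_pmf n p)) {xs. j \<le> length (filter B xs)} \<partial>p)"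
      by (simp add: map_pmf_def prob_bind_pmf)
    \<comment> \<open>A first draw in \<open>B\<close> leaves \<open>i = j - 1\<close> hits to be
      found, any other leaves all \<open>j\<close>.\<close>
    also have "\<dots> = (\<integral>x. ?P i * indicator {x. B x} x + ?P j * indicator {x. \<not> B x} x \<partial>p)"
      by (rule Bochner_Integration.integral_cong) (auto simp: Suc vimage_def indicator_def)
    also have "\<dots> = ?P i * \<beta> + ?P j * (1 - \<beta>)"
    proof -
      have "integrable (measure_pmf p) (indicator X :: _ \<Rightarrow> real)" for X
        by (rule measure_pmf.integrable_const_bound[where B = 1]) auto
      moreover have "measure_pmf.prob p {x. \<not> B x} = 1 - \<beta>"
        using measure_pmf.prob_compl[of "{x. B x}" p]
        by (simp add: \<beta>_def Compl_eq_Diff_UNIV[symmetric] Collect_neg_eq)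
      ultimately show ?thesis by (simp add: \<beta>_def)
    qed
    also have "\<dots> \<le> 2 ^ n / (2 ^ c) ^ i * \<beta> + 2 ^ n / (2 ^ c) ^ j * (1 - \<beta>)"
      by (intro add_mono mult_right_mono Suc.IH) (auto simp: \<beta>_def)
    also have "\<dots> = 2 ^ n / (2 ^ c) ^ j * (1 + (2 ^ c - 1) * \<beta>)"
      by (simp add: Suc field_simps)
    also have "\<dots> \<le> 2 ^ n / (2 ^ c) ^ j * 2"
      by (rule mult_left_mono) (use assms in \<open>auto simp: \<beta>_def\<close>)
    finally show ?thesis by (simp only: power_Suc2)
  qed
qed

text \<open>A toss chooses between two halves of \<open>Q\<close>, and the recursion samples within
  the chosen half; boundedly many fair tosses yield only dyadic probabilities, hence the power of
  two. The sampler takes the rest of the algorithm as a continuation.\<close>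

lemma uniform_sampler:
  fixes Q :: "nat set"
  assumes "finite Q" "card Q = 2 ^ r"
  shows "\<exists>pick :: (nat \<Rightarrow> 'a::comm_ring_1 probe_alg) \<Rightarrow> 'a probe_alg.
    \<forall>P k. run_alg P (pick k) = bind_pmf (pmf_of_set Q) (\<lambda>q. run_alg P (k q))"
  using assms
proof (induction r arbitrary: Q)
  case 0
  then obtain q where "Q = {q}" by (metis card_1_singletonE power_0)
  then show ?case by (auto simp: pmf_of_set_singleton bind_return_pmf intro: exI[of _ "\<lambda>k. k q"])
next
  case (Suc r)
  obtain Q1 where Q1: "Q1 \<subseteq> Q" "card Q1 = 2 ^ r"
    by (rule obtain_subset_with_card_n[of "2 ^ r" Q]) (auto simp: Suc.prems)
  define Q2 where "Q2 = Q - Q1"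
  have fin: "finite Q1" "finite Q2" using Q1 Suc.prems by (auto simp: Q2_def intro: finite_subset)
  have card2: "card Q2 = 2 ^ r" using Q1 Suc.prems fin by (simp add: Q2_def card_Diff_subset)
  have ne: "Q \<noteq> {}" "Q1 \<noteq> {}" "Q2 \<noteq> {}"
    using Q1(2) card2 Suc.prems(2) by (auto simp flip: card_gt_0_iff dest: arg_cong[where f = card])
  obtain pick1 :: "(nat \<Rightarrow> 'a probe_alg) \<Rightarrow> 'a probe_alg" where pick1:
    "run_alg P (pick1 k) = bind_pmf (pmf_of_set Q1) (\<lambda>q. run_alg P (k q))" for P k
    using Suc.IH[OF fin(1) Q1(2)] by blast
  obtain pick2 :: "(nat \<Rightarrow> 'a probe_alg) \<Rightarrow> 'a probe_alg" where pick2: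
    "run_alg P (pick2 k) = bind_pmf (pmf_of_set Q2) (\<lambda>q. run_alg P (k q))" for P k
    using Suc.IH[OF fin(2) card2] by blast
  have split: "pmf_of_set Q =
      bind_pmf (bernoulli_pmf (1/2)) (\<lambda>b. if b then pmf_of_set Q1 else pmf_of_set Q2)"
    by (rule pmf_eqI) (use Suc.prems fin ne Q1 card2 in
      \<open>auto simp: pmf_bind pmf_of_set indicator_def Q2_def field_simps\<close>)
  have "run_alg P (Toss (\<lambda>b. if b then pick1 k else pick2 k)) =
      bind_pmf (pmf_of_set Q) (\<lambda>q. run_alg P (k q))" for P k
    unfolding split bind_assoc_pmf by (auto simp: pick1 pick2 intro!: bind_pmf_cong)
  then show ?case by (intro exI[of _ "\<lambda>k. Toss (\<lambda>b. if b then pick1 k else pick2 k)"]) blast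
qed

text \<open>The evaluation point \<open>[:0, 1:]\<close> is z. The probes are non-adaptive: answers
  are only collected for \<open>k\<close>.\<close>

primrec probes ::
    "((nat \<Rightarrow> 'a probe_alg) \<Rightarrow> 'a probe_alg) \<Rightarrow> nat \<Rightarrow>
     ((nat \<times> 'a::comm_ring_1 poly) list \<Rightarrow> ('a \<times> nat) list) \<Rightarrow> 'a probe_alg" where
  "probes pick 0 k = Output (k [])"
| "probes pick (Suc n) k =
     pick (\<lambda>l. Probe l [:0, 1:] (\<lambda>r. probes pick n (\<lambda>rs. k ((l, r) # rs))))"

text \<open>As the moduli do not depend on the answers, a run is a deterministic function of
  independent draws, so success becomes an event about \<open>replicate_pmf\<close>.\<close>

lemma run_alg_probes:
  assumes pick: "\<And>P k. run_alg P (pick k) = bind_pmf (pmf_of_set Q) (\<lambda>q. run_alg P (k q))"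
    and Q: "finite Q" "Q \<noteq> {}" "\<And>l. l \<in> Q \<Longrightarrow> 1 \<le> l"
    and P: "slp_computes P f"
  shows "run_alg P (probes pick n k) =
    map_pmf (\<lambda>ls. (k (map (\<lambda>l. (l, cyc_red l f)) ls), ls)) (replicate_pmf n (pmf_of_set Q))"
proof (induction n arbitrary: k)
  case (Suc n)
  have "slp_eval_cyc P l [:0, 1:] = cyc_red l f" if "l \<in> Q" for l
    using P Q(3)[OF that] by (simp add: slp_computes_def)
  then have "run_alg P (probes pick (Suc n) k) = bind_pmf (pmf_of_set Q) (\<lambda>l.
      map_pmf (\<lambda>(xs, ls). (xs, l # ls))
        (run_alg P (probes pick n (\<lambda>rs. k ((l, cyc_red l f) # rs)))))"
    unfolding probes.simps pick run_alg.simps by (intro bind_pmf_cong refl) (simp add: Q)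
  also have "\<dots> = map_pmf (\<lambda>ls. (k (map (\<lambda>l. (l, cyc_red l f)) ls), ls)) (replicate_pmf (Suc n) (pmf_of_set Q))"
    by (simp add: Suc map_bind_pmf pmf.map_comp comp_def flip: map_pmf_def)
  finally show ?case .
qed simp

section \<open>Failure probability of the majority vote\<close>

lemma prob_decode_ge:
  fixes f :: "'a::comm_ring_1 poly"
  assumes Q: "finite Q" "Q \<noteq> {}"
    and bad: "\<And>e. e \<le> D \<Longrightarrow> 8 * card {l \<in> Q. ambiguous f e l} \<le> card Q"
    and deg: "degree f \<le> D" and w: "real (D + 1) \<le> \<mu> * 2 ^ w"
  shows "1 - \<mu> \<le> measure_pmf.prob (replicate_pmf (2 * w) (pmf_of_set Q))
    {ls. sparse_rep f (decode D (map (\<lambda>l. (l, cyc_red l f)) ls))}"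
proof -
  define M where "M = replicate_pmf (2 * w) (pmf_of_set Q)"
  define G where "G = {ls. sparse_rep f (decode D (map (\<lambda>l. (l, cyc_red l f)) ls))}"
  define F where "F e = {ls. w \<le> length (filter (ambiguous f e) ls)}" for e
  have F: "measure_pmf.prob M (F e) \<le> 1 / 2 ^ w" if "e \<le> D" for e
  proof -
    \<comment> \<open>Base \<open>2 ^ 3\<close> is admissible since a share of at most 1/8 is
      ambiguous; \<open>w\<close> hits among \<open>2 * w\<close> draws then have probability at
      most \<open>4 ^ w / 8 ^ w\<close>.\<close>
    have "(2 ^ 3 - 1) * measure_pmf.prob (pmf_of_set Q) {l. ambiguous f e l} \<le> 1"
      using bad[OF that] Q
      by (simp add: measure_pmf_of_set Int_def field_simps card_gt_0_iff)
    from prob_replicate_pmf_filter_ge[OF this, of "2 * w" w]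
    have "measure_pmf.prob M (F e) \<le> 2 ^ (2 * w) / (2 ^ 3) ^ w"
      by (simp add: M_def F_def)
    also have "\<dots> = 1 / 2 ^ w" by (simp add: power_mult power_one_over flip: power_divide)
    finally show ?thesis .
  qed
  \<comment> \<open>On the support every list has length \<open>2 * w\<close>, so failure of the
    vote forces at least \<open>w\<close> ambiguous entries.\<close>
  have "measure_pmf.prob M (UNIV - G) = measure_pmf.prob M ((UNIV - G) \<inter> set_pmf M)"
    by (simp add: measure_Int_set_pmf)
  also have "\<dots> \<le> measure_pmf.prob M (\<Union>e\<in>{..D}. F e)"
  proof (rule measure_pmf.finite_measure_mono)
    show "(UNIV - G) \<inter> set_pmf M \<subseteq> (\<Union>e\<in>{..D}. F e)"
    proof
      fix ls assume ls: "ls \<in> (UNIV - G) \<inter> set_pmf M"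
      then have "length ls = 2 * w" by (auto simp: M_def set_replicate_pmf)
      with ls show "ls \<in> (\<Union>e\<in>{..D}. F e)"
        using sparse_rep_decode_images[OF deg, of ls] by (force simp: G_def F_def not_le)
    qed
  qed simp
  also have "\<dots> \<le> (\<Sum>e\<le>D. measure_pmf.prob M (F e))"
    by (rule measure_pmf.finite_measure_subadditive_finite) auto
  also have "\<dots> \<le> (\<Sum>e\<le>D. 1 / 2 ^ w)" by (intro sum_mono F) auto
  also have "\<dots> \<le> \<mu>" using w by (simp add: field_simps)
  finally show ?thesis
    using measure_pmf.prob_compl[of G M] by (simp add: M_def G_def)
qed

text \<open>A modulus ambiguous for \<open>e\<close> divides the distance from \<open>e\<close> to
  another exponent of \<open>f\<close>. There are at most \<open>T\<close> such distances, all
  between 1 and \<open>D\<close>.\<close>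

lemma card_ambiguous_le:
  fixes f :: "'a::comm_ring_1 poly"
  assumes "\<And>d. 0 < d \<Longrightarrow> d \<le> D \<Longrightarrow> card {l \<in> Q. l dvd d} \<le> b"
    and "finite Q" "degree f \<le> D" "sparsity f \<le> T" "e \<le> D"
  shows "card {l \<in> Q. ambiguous f e l} \<le> T * b"
proof -
  define S where "S = {i. coeff f i \<noteq> 0}"
  \<comment> \<open>The absolute difference, since subtraction of natural numbers truncates.\<close>
  define dist where "dist i = (if i \<le> e then e - i else i - e)" for i
  have S: "S \<subseteq> {..D}" unfolding S_def using assms(3) le_degree[of f] by (auto intro: order_trans)
  then have fin: "finite S" by (rule finite_subset) simp
  have "l dvd dist i" if "i mod l = e mod l" for i l
    unfolding dist_def using that mod_eq_dvd_iff_nat[of i e l] mod_eq_dvd_iff_nat[of e i l] by auto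
  then have "{l \<in> Q. ambiguous f e l} \<subseteq> (\<Union>i\<in>S - {e}. {l \<in> Q. l dvd dist i})"
    by (fastforce simp: ambiguous_def S_def)
  then have "card {l \<in> Q. ambiguous f e l} \<le> card (\<Union>i\<in>S - {e}. {l \<in> Q. l dvd dist i})"
    using fin assms(2) by (intro card_mono) auto
  also have "\<dots> \<le> (\<Sum>i\<in>S - {e}. card {l \<in> Q. l dvd dist i})"
    by (rule card_UN_le) (use fin in auto)
  also have "\<dots> \<le> (\<Sum>i\<in>S - {e}. b)"
    by (intro sum_mono assms(1)) (use S assms(5) in \<open>auto simp: dist_def\<close>)
  also have "\<dots> \<le> T * b"
    using assms(4) card_mono[of S "S - {e}"] fin by (auto simp: sparsity_def S_def)
  finally show ?thesis .
qed

section \<open>Choice of parameters\<close>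

text \<open>The length of \<open>D\<close> in binary.\<close>

definition bits :: "nat \<Rightarrow> nat" where
  "bits D = nat \<lceil>log 2 (real D + 1)\<rceil>"

lemma less_power_bits: "D < 2 ^ bits D"
proof -
  have "log 2 (real D + 1) \<le> real (bits D)" unfolding bits_def by linarith
  then have "real D + 1 \<le> 2 powr real (bits D)" by (simp add: log_le_iff)
  then have "real (D + 1) \<le> real (2 ^ bits D)" by (simp add: powr_realpow)
  then show ?thesis by (simp only: of_nat_le_iff)
qed

lemma bits_ge_2:
  assumes "2 \<le> D"
  shows "2 \<le> bits D"
proof -
  have "(2::nat) < 2 ^ bits D" using assms less_power_bits[of D] by linarith
  then have "(2::nat) ^ 1 < 2 ^ bits D" by simp
  then have "1 < bits D" by (rule power_less_imp_less_exp[rotated]) simp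
  then show ?thesis by simp
qed

text \<open>From \<open>D + 1 \<le> D ^ 2\<close>, the rounded logarithm is at most
  \<open>2 * log 2 D + 1\<close>, hence at most \<open>3 * log 2 D\<close>; the factor
  \<open>1 / ln 2 \<le> 3 / 2\<close> gives 9/2.\<close>

lemma bits_le:
  assumes "2 \<le> D"
  shows "real (bits D) \<le> 9 / 2 * ln (real D)"
proof -
  have "ln 2 \<le> ln (real D)" using assms by simp
  have "D + 1 \<le> D ^ 2" 
    using assms mult_le_mono1[of 2 D D] unfolding power2_eq_square by linarith
  then have "real D + 1 \<le> real D ^ 2" by (metis of_nat_1 of_nat_add of_nat_le_iff of_nat_power)
  then have "ln (real D + 1) \<le> 2 * ln (real D)"
    using assms ln_mono[of "real D + 1" "real D ^ 2"] by (simp add: ln_realpow)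
  then have "log 2 (real D + 1) \<le> 2 * ln (real D) / ln 2"
    by (simp add: log_def divide_right_mono)
  moreover have "0 \<le> log 2 (real D + 1)" by simp
  then have "real (bits D) \<le> log 2 (real D + 1) + 1" unfolding bits_def by linarith
  moreover have "1 \<le> ln (real D) / ln 2" using \<open>ln 2 \<le> ln (real D)\<close> by simp
  ultimately have "real (bits D) \<le> 3 * (ln (real D) / ln 2)"
    unfolding times_divide_eq_right[symmetric] by linarith
  also have "\<dots> \<le> 3 * (ln (real D) / (2 / 3))"
    using assms ln2_ge_two_thirds by (intro mult_left_mono divide_left_mono) auto
  finally show ?thesis by simp
qed

text \<open>
  By \<open>card_primes_ge\<close>, \<open>s * j\<close> bounds the range needed for \<open>j\<close> primes as soon as this range has at
  most \<open>s\<close> bits; here \<open>j = 16 * T * bits D\<close>, and \<open>s = 10 * bits D\<close> bits suffice because \<open>T \<le> D\<close>.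
\<close>

lemma exists_prime_moduli:
  assumes "2 \<le> D" "1 \<le> T" "T \<le> D"
  obtains Q r where "finite Q" "card Q = 2 ^ r" "8 * (T * bits D) \<le> 2 ^ r"
    "\<And>l. l \<in> Q \<Longrightarrow> prime l" "\<And>l. l \<in> Q \<Longrightarrow> l \<le> 320 * T * (bits D)\<^sup>2"
proof -
  define b where "b = bits D"
  have b: "2 \<le> b" "T \<le> 2 ^ b"
    using bits_ge_2[OF assms(1)] less_power_bits[of D] assms by (auto simp: b_def)
  have "1 \<le> 8 * (T * b)" using assms b by simp
  \<comment> \<open>Rounding up to a power of two, as \<open>uniform_sampler\<close> requires, at
    most doubles the number of primes.\<close>
  then obtain r where r: "8 * (T * b) \<le> 2 ^ r" "2 ^ r < 16 * (T * b)"
  proof -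
    define r where "r = (LEAST r. 8 * (T * b) \<le> 2 ^ r)"
    have r1: "8 * (T * b) \<le> 2 ^ r" unfolding r_def
      by (rule LeastI[of _ "8 * (T * b)"]) (simp add: less_imp_le)
    have "2 ^ r < 16 * (T * b)"
    proof (cases r)
      case 0
      then have "2 ^ r = (1::nat)" by simp
      then show ?thesis using \<open>1 \<le> 8 * (T * b)\<close> by linarith
    next
      case (Suc q)
      have "\<not> 8 * (T * b) \<le> 2 ^ q" unfolding r_def
        by (rule not_less_Least) (use Suc in \<open>simp add: r_def\<close>)
      then show ?thesis using Suc by simp
    qed
    with r1 that show ?thesis by blast
  qed
  have "2 * (10 * b * (16 * (T * b))) = 320 * T * b\<^sup>2"
    by (simp add: power2_eq_square)
  \<comment> \<open>Here 320 is \<open>2 * 10 * 16\<close> and lies below \<open>2 ^ 9\<close>; the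
    resulting exponent \<open>9 + 3 * b\<close> is at most \<open>10 * b\<close> because
    \<open>b \<ge> 2\<close>.\<close>
  have "320 * T * b\<^sup>2 \<le> 2 ^ 9 * 2 ^ b * (2 ^ b)\<^sup>2"
    using b less_exp[of b] by (intro mult_le_mono power_mono) auto
  also have "\<dots> = 2 ^ (9 + b + b * 2)"
    by (simp only: power_add power_mult)
  also have "\<dots> \<le> (2 :: nat) ^ (10 * b)" using b by (intro power_increasing) auto
  finally have "16 * (T * b) \<le> card {p::nat. prime p \<and> p \<le> 320 * T * b\<^sup>2}"
    using card_primes_ge[of "16 * (T * b)" "10 * b"] assms b
    unfolding \<open>2 * (10 * b * (16 * (T * b))) = 320 * T * b\<^sup>2\<close> by simp
  with r(2) have "2 ^ r \<le> card {p::nat. prime p \<and> p \<le> 320 * T * b\<^sup>2}" by linarith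
  then obtain Q where "Q \<subseteq> {p::nat. prime p \<and> p \<le> 320 * T * b\<^sup>2}" "card Q = 2 ^ r" "finite Q"
    by (rule obtain_subset_with_card_n)
  with r show ?thesis by (intro that[of Q r]) (auto simp: b_def)
qed

section \<open>Algorithms with explicit bounds\<close>

definition solves ::
    "nat \<Rightarrow> nat \<Rightarrow> real \<Rightarrow> real \<Rightarrow> real \<Rightarrow> 'a::comm_ring_1 probe_alg \<Rightarrow> bool" where
  "solves T D \<mu> N M A \<longleftrightarrow> (\<forall>(f :: 'a poly) P.
     slp_computes P f \<longrightarrow> sparsity f \<le> T \<longrightarrow> degree f \<le> D \<longrightarrow>
       measure_pmf.prob (run_alg P A) {(xs, ls). sparse_rep f xs} \<ge> 1 - \<mu> \<and>
       (\<forall>(xs, ls) \<in> set_pmf (run_alg P A).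
          real (length ls) \<le> N \<and> (\<forall>l \<in> set ls. 1 \<le> l \<and> real l \<le> M)))"

text \<open>Exponents up to \<open>D\<close> have distinct residues modulo \<open>D + 1\<close>, so
  one probe is exact; modulo \<open>D\<close> the exponents 0 and \<open>D\<close> would
  collide.\<close>

lemma exists_alg_single_probe:
  assumes "0 < \<mu>"
  shows "\<exists>A :: 'a::comm_ring_1 probe_alg. solves T D \<mu> 1 (real (D + 1)) A"
proof -
  define A :: "'a probe_alg" where
    "A = Probe (D + 1) [:0, 1:] (\<lambda>r. Output (decode D [(D + 1, r)]))"
  have "run_alg P A = return_pmf (decode D [(D + 1, cyc_red (D + 1) f)], [D + 1])"
    if "slp_computes P f" for P f
    using that by (simp add: A_def slp_computes_def)
  moreover have "sparse_rep f (decode D [(D + 1, cyc_red (D + 1) f)])" if "degree f \<le> D" for f :: "'a poly"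
  proof -
    have "i \<le> D" if "coeff f i \<noteq> 0" for i
      using le_degree[OF that] \<open>degree f \<le> D\<close> by simp
    then have "\<not> ambiguous f e (D + 1)" if "e \<le> D" for e
      using that by (force simp: ambiguous_def less_Suc_eq_le)
    then show ?thesis
      using sparse_rep_decode_images[of f D "[D + 1]"] that by simp
  qed
  ultimately have "solves T D \<mu> 1 (real (D + 1)) A"
    using assms unfolding solves_def by (auto simp: indicator_def)
  then show ?thesis ..
qed

text \<open>Each distance has at most \<open>bits D\<close> prime divisors, so at most
  \<open>T * bits D\<close> moduli are ambiguous for a given exponent, an eighth of \<open>Q\<close>
  at most.\<close>

lemma exists_alg_prime_probes:
  assumes "2 \<le> D" "1 \<le> T" "T \<le> D" and w: "real (D + 1) \<le> \<mu> * 2 ^ w"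
  shows "\<exists>A :: 'a::comm_ring_1 probe_alg.
    solves T D \<mu> (real (2 * w)) (real (320 * T * (bits D)\<^sup>2)) A"
proof -
  obtain Q r where Q: "finite Q" "card Q = 2 ^ r" "8 * (T * bits D) \<le> 2 ^ r"
    "\<And>l. l \<in> Q \<Longrightarrow> prime l" "\<And>l. l \<in> Q \<Longrightarrow> l \<le> 320 * T * (bits D)\<^sup>2"
    using exists_prime_moduli[OF assms(1-3)] by blast
  have ne: "Q \<noteq> {}" using Q(2) by auto
  have pos: "1 \<le> l" if "l \<in> Q" for l using Q(4)[OF that] prime_ge_1_nat by blast
  obtain pick :: "(nat \<Rightarrow> 'a probe_alg) \<Rightarrow> 'a probe_alg" where pick:
    "\<And>P k. run_alg P (pick k) = bind_pmf (pmf_of_set Q) (\<lambda>q. run_alg P (k q))"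
    using uniform_sampler[OF Q(1,2)] by blast
  define A where "A = probes pick (2 * w) (decode D)"
  have few: "card {l \<in> Q. l dvd d} \<le> bits D" if "0 < d" "d \<le> D" for d
  proof -
    have "d < 2 ^ bits D" using that less_power_bits[of D] by linarith
    note div = card_prime_divisors_le[OF that(1) this]
    have "card {l \<in> Q. l dvd d} \<le> card {p. prime p \<and> p dvd d}"
      using div(1) by (rule card_mono) (use Q(4) in auto)
    then show ?thesis using div(2) by linarith
  qed
  have "solves T D \<mu> (real (2 * w)) (real (320 * T * (bits D)\<^sup>2)) A"
    unfolding solves_def
  proof (intro allI impI conjI)
    fix f :: "'a poly" and P
    assume P: "slp_computes P f" and sp: "sparsity f \<le> T" and deg: "degree f \<le> D"
    note run = run_alg_probes[OF pick Q(1) ne pos P, of "2 * w" "decode D", folded A_def]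
    have "8 * card {l \<in> Q. ambiguous f e l} \<le> card Q" if "e \<le> D" for e
      using card_ambiguous_le[OF few Q(1) deg sp that] Q(2,3) by linarith
    from prob_decode_ge[OF Q(1) ne this deg w]
    show "1 - \<mu> \<le> measure_pmf.prob (run_alg P A) {(xs, ls). sparse_rep f xs}"
      by (simp add: run vimage_def)
    have "real (length ls) \<le> real (2 * w) \<and>
        (\<forall>l \<in> set ls. 1 \<le> l \<and> real l \<le> real (320 * T * (bits D)\<^sup>2))"
      if "(xs, ls) \<in> set_pmf (run_alg P A)" for xs ls
    proof -
      have "length ls = 2 * w" "set ls \<subseteq> Q"
        using that Q(1) ne by (auto simp: run set_replicate_pmf)
      then show ?thesis
        using Q(5) pos by (simp add: subset_iff del: of_nat_mult)
    qed
    then show "\<forall>(xs, ls) \<in> set_pmf (run_alg P A). real (length ls) \<le> real (2 * w) \<and>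
        (\<forall>l \<in> set ls. 1 \<le> l \<and> real l \<le> real (320 * T * (bits D)\<^sup>2))"
      by blast
  qed
  then show ?thesis ..
qed

section \<open>Asymptotic form of the bounds\<close>

lemma soft_O_I:
  assumes "\<And>x. x \<in> S \<Longrightarrow> \<bar>\<phi> x\<bar> \<le> C * \<psi> x"
  shows "\<phi> \<in> soft_O S \<psi>"
proof -
  \<comment> \<open>The logarithmic exponent is taken to be 0. Because \<open>0 powr 0 = 0\<close>,
    the factor \<open>ln (\<psi> x) powr 0\<close> is 1 only away from
    \<open>\<psi> x = 1\<close>.\<close>
  have "\<forall>\<^sub>F x in filtercomap \<psi> at_top. 1 < \<psi> x"
    by (rule eventually_filtercomapI[OF eventually_gt_at_top])
  then have "\<forall>\<^sub>F x in inf (filtercomap \<psi> at_top) (principal S).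
      norm (\<phi> x) \<le> C * norm (\<psi> x * ln (\<psi> x) powr 0)"
    unfolding eventually_inf_principal by eventually_elim (auto simp: assms)
  then have "\<phi> \<in> O[inf (filtercomap \<psi> at_top) (principal S)](\<lambda>x. \<psi> x * ln (\<psi> x) powr 0)"
    by (rule bigoI)
  then show ?thesis unfolding soft_O_def by (intro UN_I[of 0]) auto
qed

text \<open>The range in which random primes are used. The rest of \<open>params\<close> is the case
  \<open>T > D\<close>, where a probe of degree \<open>D + 1 \<le> T\<close> is affordable.\<close>

definition sampled :: "nat \<times> nat \<times> real \<Rightarrow> bool" where
  "sampled = (\<lambda>(T, D, \<mu>). 2 \<le> T \<and> T \<le> D \<and> 0 < \<mu> \<and> \<mu> < 1)"

text \<open>Chosen so that \<open>2 ^ half_count D \<mu>\<close> is at least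
  \<open>(D + 1) / \<mu>\<close>, as the union bound over the exponents demands.\<close>

definition half_count :: "nat \<Rightarrow> real \<Rightarrow> nat" where
  "half_count D \<mu> = bits D + nat \<lceil>log 2 (1 / \<mu>)\<rceil>"

definition num_probes :: "nat \<times> nat \<times> real \<Rightarrow> real" where
  "num_probes = (\<lambda>(T, D, \<mu>). if sampled (T, D, \<mu>) then real (2 * half_count D \<mu>) else 1)"

definition max_degree :: "nat \<times> nat \<times> real \<Rightarrow> real" where
  "max_degree = (\<lambda>(T, D, \<mu>).
     if sampled (T, D, \<mu>) then real (320 * T * (bits D)\<^sup>2) else real (D + 1))"

lemma half_count_ge:
  assumes "0 < \<mu>"
  shows "real (D + 1) \<le> \<mu> * 2 ^ half_count D \<mu>"
proof -
  let ?c = "nat \<lceil>log 2 (1 / \<mu>)\<rceil>"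
  have "log 2 (1 / \<mu>) \<le> real ?c" by linarith
  then have "1 / \<mu> \<le> 2 powr real ?c" using assms by (simp add: log_le_iff)
  then have "1 \<le> \<mu> * 2 ^ ?c" using assms by (simp add: powr_realpow field_simps)
  moreover have "real (D + 1) \<le> real (2 ^ bits D)"
    using less_power_bits[of D] by (intro of_nat_mono) simp
  ultimately have "real (D + 1) * 1 \<le> real (2 ^ bits D) * (\<mu> * 2 ^ ?c)"
    by (intro mult_mono) auto
  then show ?thesis by (simp add: half_count_def power_add algebra_simps)
qed

lemma exists_alg:
  assumes "0 < \<mu>"
  shows "\<exists>A :: 'a::comm_ring_1 probe_alg.
    solves T D \<mu> (num_probes (T, D, \<mu>)) (max_degree (T, D, \<mu>)) A"
proof (cases "sampled (T, D, \<mu>)")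
  case True
  then show ?thesis
    using exists_alg_prime_probes[OF _ _ _ half_count_ge[OF assms], of D T]
    by (auto simp: num_probes_def max_degree_def sampled_def)
next
  case False
  then show ?thesis
    using exists_alg_single_probe[OF assms, of T D]
    by (auto simp: num_probes_def max_degree_def)
qed

lemma ln_ge_two_thirds:
  assumes "2 \<le> (n::nat)"
  shows "2 / 3 \<le> ln (real n)"
proof -
  have "ln 2 \<le> ln (real n)" using assms by simp
  then show ?thesis using ln2_ge_two_thirds by linarith
qed

text \<open>With \<open>q = ln (1 / \<mu>)\<close>, twice the half count is at most
  \<open>9 * ln D + 3 * q + 2\<close>, and \<open>2 \<le> 3 * ln D\<close> gives 12. Inserting the
  factor \<open>ln T \<ge> 2 / 3\<close> turns 12 into 18.\<close>

lemma num_probes_soft_O: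
  "num_probes \<in> soft_O params (\<lambda>(T, D, \<mu>). ln (real T) * (ln (real D) + ln (1 / \<mu>)))"
proof (rule soft_O_I[where C = 18], clarify)
  fix T D :: nat and \<mu> :: real
  assume "(T, D, \<mu>) \<in> params"
  then have TD: "2 \<le> T" "2 \<le> D" "0 < \<mu>" "\<mu> < 1" by (auto simp: params_def)
  define q where "q = ln (1 / \<mu>)"
  have q: "0 \<le> q" using TD by (simp add: q_def)
  have lnT: "2 / 3 \<le> ln (real T)" and lnD: "2 / 3 \<le> ln (real D)"
    using TD ln_ge_two_thirds by auto
  have "12 * (ln (real D) + q) = 18 * (2 / 3 * (ln (real D) + q))" by simp
  also have "\<dots> \<le> 18 * (ln (real T) * (ln (real D) + q))"
    using lnT lnD q by (intro mult_left_mono mult_right_mono) auto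
  finally have \<psi>: "12 * (ln (real D) + q) \<le> 18 * (ln (real T) * (ln (real D) + q))" .
  have "log 2 (1 / \<mu>) = q / ln 2" by (simp add: log_def q_def)
  also have "\<dots> \<le> q / (2 / 3)" using q ln2_ge_two_thirds by (intro divide_left_mono) auto
  finally have "log 2 (1 / \<mu>) \<le> 3 / 2 * q" by simp
  moreover have "0 \<le> log 2 (1 / \<mu>)" using TD by simp
  ultimately have "real (nat \<lceil>log 2 (1 / \<mu>)\<rceil>) \<le> 3 / 2 * q + 1" by linarith
  then have "real (2 * half_count D \<mu>) \<le> 12 * (ln (real D) + q)"
    using bits_le[OF TD(2)] lnD q by (simp add: half_count_def)
  moreover have "1 \<le> 12 * (ln (real D) + q)" using lnD q by simp
  ultimately have "\<bar>num_probes (T, D, \<mu>)\<bar> \<le> 12 * (ln (real D) + q)"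
    by (simp add: num_probes_def)
  with \<psi> show "\<bar>num_probes (T, D, \<mu>)\<bar> \<le> 18 * (ln (real T) * (ln (real D) + ln (1 / \<mu>)))"
    by (simp add: q_def)
qed

text \<open>The constant is \<open>320 * (9 / 2) ^ 2\<close>. For \<open>T > D\<close> the degree
  \<open>D + 1\<close> is at most \<open>T\<close>, and \<open>ln D\<close> is bounded below by
  2/3.\<close>

lemma max_degree_bigo:
  "max_degree \<in> O[principal params](\<lambda>(T, D, \<mu>). real T * (ln (real D))\<^sup>2)"
proof (rule bigoI[where c = 6480], unfold eventually_principal, clarify)
  fix T D :: nat and \<mu> :: real
  assume "(T, D, \<mu>) \<in> params"
  then have TD: "2 \<le> T" "2 \<le> D" "0 < \<mu>" "\<mu> < 1" by (auto simp: params_def)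
  show "norm (max_degree (T, D, \<mu>)) \<le> 6480 * norm (real T * (ln (real D))\<^sup>2)"
  proof (cases "sampled (T, D, \<mu>)")
    case True
    have "real (bits D) ^ 2 \<le> (9 / 2 * ln (real D)) ^ 2"
      using bits_le[OF TD(2)] by (intro power_mono) auto
    then have "320 * real T * real (bits D) ^ 2 \<le> 320 * real T * (9 / 2 * ln (real D)) ^ 2"
      by (intro mult_left_mono) auto
    with True show ?thesis by (simp add: max_degree_def power_mult_distrib power_divide)
  next
    case False
    then have "D + 1 \<le> T" using TD by (auto simp: sampled_def)
    have "(2 / 3)\<^sup>2 \<le> (ln (real D))\<^sup>2"
      using ln_ge_two_thirds[OF TD(2)] by (intro power_mono) auto
    then have "1 \<le> 6480 * (ln (real D))\<^sup>2" by (simp add: power_divide)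
    then have "real T * 1 \<le> real T * (6480 * (ln (real D))\<^sup>2)"
      by (intro mult_left_mono) auto
    moreover have "real (D + 1) \<le> real T" using \<open>D + 1 \<le> T\<close> by (simp only: of_nat_le_iff)
    ultimately have "real (D + 1) \<le> 6480 * (real T * (ln (real D))\<^sup>2)" by linarith
    with False show ?thesis by (simp add: max_degree_def abs_mult)
  qed
qed

theorem theorem5:
  shows "\<exists>(A :: nat \<Rightarrow> nat \<Rightarrow> real \<Rightarrow> 'a::comm_ring_1 probe_alg)
      (n :: nat \<times> nat \<times> real \<Rightarrow> real) (m :: nat \<times> nat \<times> real \<Rightarrow> real).
    n \<in> soft_O params (\<lambda>(T, D, \<mu>). ln (real T) * (ln (real D) + ln (1 / \<mu>))) \<and>
    m \<in> O[principal params](\<lambda>(T, D, \<mu>). real T * (ln (real D))\<^sup>2) \<and>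
    (\<forall>(f :: 'a poly) (P :: 'a slp) (T :: nat) (D :: nat) (\<mu> :: real).
       slp_computes P f \<longrightarrow> sparsity f \<le> T \<longrightarrow> degree f \<le> D \<longrightarrow> 0 < \<mu> \<longrightarrow>
         measure_pmf.prob (run_alg P (A T D \<mu>)) {(xs, ls). sparse_rep f xs} \<ge> 1 - \<mu> \<and>
         (\<forall>(xs, ls) \<in> set_pmf (run_alg P (A T D \<mu>)).
            real (length ls) \<le> n (T, D, \<mu>) \<and>
            (\<forall>l \<in> set ls. 1 \<le> l \<and> real l \<le> m (T, D, \<mu>))))"

proof -
  obtain A :: "nat \<Rightarrow> nat \<Rightarrow> real \<Rightarrow> 'a probe_alg" where
    "solves T D \<mu> (num_probes (T, D, \<mu>)) (max_degree (T, D, \<mu>)) (A T D \<mu>)" if "0 < \<mu>" for T D \<mu>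
  proof -
    \<comment> \<open>With \<open>0 < \<mu>\<close> under the existential quantifier, choice gives a
      function of all parameters, independent of \<open>f\<close> and \<open>P\<close>.\<close>
    have "\<forall>T D \<mu>. \<exists>A :: 'a probe_alg. 0 < \<mu> \<longrightarrow>
        solves T D \<mu> (num_probes (T, D, \<mu>)) (max_degree (T, D, \<mu>)) A"
      using exists_alg by blast
    then show thesis using that by metis
  qed
  then show ?thesis
    by (intro exI[of _ A] exI[of _ num_probes] exI[of _ max_degree]
          conjI num_probes_soft_O max_degree_bigo) (auto simp: solves_def)
qed

end
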